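(* Let $d\ge 1$ be an integer. If the groups $\Gamma_1,\dots,\Gamma_d$ each have a finite generating set consisting of elements of finite order, then at least one of the $\Gamma_i$ has a fixed point whenever $\Gamma_1\times\dots\times\Gamma_d$ acts by isometries on a complete $\mathrm{CAT}(0)$ space of dimension less than $d$.
   Context: $\mathrm{CAT}(0)$ spaces are non-empty; they are not assumed locally compact. An action by isometries of $\Gamma$ on $X$ is a homomorphism $\Gamma\to\mathrm{Isom}(X)$ (no properness or semisimplicity is assumed). A subgroup $H$ has a fixed point if there is $x\in X$ with $hx=x$ for all $h\in H$. Dimension means topological covering dimension: $\dim(X)\le k$ if for every closed subspace $K\subseteq X$ and every $r\ge k$, every continuous map $K\to\mathbb{S}^r$ to the $r$-sphere extends to a continuous map $X\to\mathbb{S}^r$. *)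

theory Defs
  imports "HOL-Analysis.Analysis" "HOL-Algebra.Product_Groups" "HOL-Algebra.Bij" "HOL-Algebra.Generated_Groups"
begin

section \<open>CAT(0) spaces\<close>

definition geodesic_path :: "'a metric \<Rightarrow> 'a \<Rightarrow> 'a \<Rightarrow> (real \<Rightarrow> 'a) \<Rightarrow> bool" where
  "geodesic_path m x y c \<longleftrightarrow>
     c \<in> {0..mdist m x y} \<rightarrow> mspace m \<and> c 0 = x \<and> c (mdist m x y) = y \<and>
     (\<forall>s\<in>{0..mdist m x y}. \<forall>t\<in>{0..mdist m x y}. mdist m (c s) (c t) = \<bar>s - t\<bar>)"

definition geodesic_segment :: "'a metric \<Rightarrow> 'a \<Rightarrow> 'a \<Rightarrow> 'a set \<Rightarrow> bool" where
  "geodesic_segment m x y S \<longleftrightarrow> (\<exists>c. geodesic_path m x y c \<and> S = c ` {0..mdist m x y})"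

definition geodesic_metric :: "'a metric \<Rightarrow> bool" where
  "geodesic_metric m \<longleftrightarrow> (\<forall>x\<in>mspace m. \<forall>y\<in>mspace m. \<exists>S. geodesic_segment m x y S)"

text \<open>Pairs consisting of a point of the side \<open>S\<close> from \<open>p\<close> to \<open>q\<close> and its comparison point on
  the side from \<open>p'\<close> to \<open>q'\<close> of a comparison triangle in the Euclidean plane.\<close>

definition comparison_side ::
  "'a metric \<Rightarrow> 'a set \<Rightarrow> 'a \<Rightarrow> real^2 \<Rightarrow> real^2 \<Rightarrow> ('a \<times> (real^2)) set" where
  "comparison_side m S p p' q' =
     {(x, x'). x \<in> S \<and> x' \<in> closed_segment p' q' \<and> dist p' x' = mdist m p x}"

definition CAT0 :: "'a metric \<Rightarrow> bool" where
  "CAT0 m \<longleftrightarrow> mspace m \<noteq> {} \<and> geodesic_metric m \<and>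
    (\<forall>p\<in>mspace m. \<forall>q\<in>mspace m. \<forall>r\<in>mspace m. \<forall>A B C. \<forall>p' q' r' :: real^2.
       geodesic_segment m p q A \<and> geodesic_segment m q r B \<and> geodesic_segment m r p C \<and>
       dist p' q' = mdist m p q \<and> dist q' r' = mdist m q r \<and> dist r' p' = mdist m r p \<longrightarrow>
       (let T = comparison_side m A p p' q' \<union> comparison_side m B q q' r' \<union>
                comparison_side m C r r' p'
        in \<forall>(x, x')\<in>T. \<forall>(y, y')\<in>T. mdist m x y \<le> dist x' y'))"


section \<open>Covering dimension\<close>

definition covering_dim_le :: "'a topology \<Rightarrow> nat \<Rightarrow> bool" where
  "covering_dim_le T k \<longleftrightarrow>
     (\<forall>K r f. closedin T K \<and> k \<le> r \<and> continuous_map (subtopology T K) (nsphere r) f \<longrightarrow>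
        (\<exists>g. continuous_map T (nsphere r) g \<and> (\<forall>x\<in>K. g x = f x)))"

text \<open>The value is \<open>\<infinity>\<close> if \<^const>\<open>covering_dim_le\<close> holds for no natural number.\<close>

definition covering_dim :: "'a topology \<Rightarrow> enat" where
  "covering_dim T = Inf {enat k |k. covering_dim_le T k}"


section \<open>Isometric actions\<close>

text \<open>As in \<^const>\<open>BijGroup\<close>, the elements are functions that are \<^const>\<open>undefined\<close> outside
  the space, so that distinct elements differ as maps of the space.\<close>

definition isometry_group :: "'a metric \<Rightarrow> ('a \<Rightarrow> 'a) monoid" where
  "isometry_group m = BijGroup (mspace m)
     \<lparr>carrier := {f \<in> Bij (mspace m).
        \<forall>x\<in>mspace m. \<forall>y\<in>mspace m. mdist m (f x) (f y) = mdist m x y}\<rparr>"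

definition has_fixed_point :: "'a metric \<Rightarrow> ('g \<Rightarrow> 'a \<Rightarrow> 'a) \<Rightarrow> 'g set \<Rightarrow> bool" where
  "has_fixed_point m \<phi> H \<longleftrightarrow> (\<exists>x\<in>mspace m. \<forall>h\<in>H. \<phi> h x = x)"


section \<open>Groups and direct products\<close>

definition factor_subgroup :: "'i set \<Rightarrow> ('i \<Rightarrow> ('g, 'b) monoid_scheme) \<Rightarrow> 'i \<Rightarrow> ('i \<Rightarrow> 'g) set" where
  "factor_subgroup I G i =
     {x \<in> carrier (product_group I G). \<forall>j\<in>I - {i}. x j = \<one>\<^bsub>G j\<^esub>}"

definition fin_gen_by_torsion :: "('g, 'b) monoid_scheme \<Rightarrow> bool" where
  "fin_gen_by_torsion G \<longleftrightarrow>
     (\<exists>S. finite S \<and> S \<subseteq> carrier G \<and> generate G S = carrier G \<and>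
        (\<forall>s\<in>S. \<exists>n::nat. n > 0 \<and> s [^]\<^bsub>G\<^esub> n = \<one>\<^bsub>G\<^esub>))"

end

theory Submission
  imports Defs
begin

text \<open>Suppose that no factor has a fixed point. A torsion isometry \<open>T\<close> of a complete CAT(0) space does
  have one: the sum of the squared distances to an orbit of \<open>T\<close> has a unique minimiser, which \<open>T\<close>
  must fix (\<open>torsion_has_fixed_point\<close>). Adding the torsion generators of the \<open>i\<close>-th factor one at a
  time, there is therefore a first moment when the common fixed points disappear. It yields two
  disjoint non-empty closed convex sets: the fixed set \<open>A i\<close> of the earlier generators and the fixed
  set \<open>B i\<close> of the next one (\<open>Fix_empty_imp_disjoint_pair\<close>).

  Sets that belong to different factors meet, because the factors commute: the nearest-point
  projection onto the fixed set of one family commutes with the other family and so carries a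
  fixed point of the latter to a common fixed point (\<open>Fix_commuting_nonempty\<close>). Hence for
  every choice of one of \<open>A i\<close>, \<open>B i\<close> for each \<open>i\<close>, the \<open>d\<close> chosen sets have a common point. The
  nerve of this family is the boundary of the \<open>d\<close>-dimensional cross-polytope, a \<open>(d-1)\<close>-sphere, and a
  contractible space of dimension less than \<open>d\<close> should not admit such a family.

  This last claim (\<open>essential_pairs_meet\<close>) has an elementary proof. The points common to the
  chosen sets serve as the \<open>2^d\<close> corners of a cube, which is filled by iterated geodesics. By
  convexity, the face \<open>x i = 0\<close> lands in \<open>A i\<close> and the face \<open>x i = 1\<close> in \<open>B i\<close>. Urysohn functions
  that are \<open>-1\<close> on \<open>A i\<close> and \<open>1\<close> on \<open>B i\<close> combine, after normalisation, to a map from the union of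
  all \<open>A i\<close> and \<open>B i\<close> to the \<open>(d-1)\<close>-sphere. By the bound on the dimension it extends to the whole space.
  Composing the extension with the cube gives a map from the \<open>d\<close>-cube to the \<open>(d-1)\<close>-sphere whose
  \<open>i\<close>-th coordinate changes sign between the two \<open>i\<close>-th faces. By the Poincare-Miranda theorem, which is
  derived here from Kuhn's combinatorial lemma, such a map has a zero; but the sphere omits the
  origin.\<close>

section \<open>Geodesics and convexity in CAT(0) spaces\<close>

lemma comparison_triangle_exists:
  fixes a b c :: real
  assumes "0 \<le> a" "0 \<le> c" "\<bar>a - c\<bar> \<le> b" "b \<le> a + c"
  obtains p q r :: "real^2" where "dist p q = a" "dist q r = b" "dist r p = c"
proof (cases "a = 0")
  case True
  show thesis
  proof (rule that[of 0 0 "vector [c, 0]"])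
    show "dist (0::real^2) 0 = a" using True by simp
    show "dist 0 (vector [c, 0] :: real^2) = b" "dist (vector [c, 0] :: real^2) 0 = c"
      using assms True by (simp_all add: dist_norm norm_vec_def L2_set_def sum_2)
  qed
next
  case False
  define u where "u = (a\<^sup>2 + c\<^sup>2 - b\<^sup>2) / (2 * a)"
  define v where "v = sqrt (c\<^sup>2 - u\<^sup>2)"
  have ua: "2 * a * u = a\<^sup>2 + c\<^sup>2 - b\<^sup>2"
    using False by (simp add: u_def)
  have "0 \<le> b" using assms by linarith
  have "b\<^sup>2 \<le> (a + c)\<^sup>2"
    using assms \<open>0 \<le> b\<close> by (intro power_mono) auto
  moreover have "(a - c)\<^sup>2 \<le> b\<^sup>2"
    using assms(3) abs_le_square_iff[of "a - c" b] \<open>0 \<le> b\<close> by simp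
  ultimately have "\<bar>2 * a * u\<bar> \<le> 2 * a * c"
    unfolding ua by (simp add: power2_eq_square algebra_simps abs_le_iff)
  then have "\<bar>u\<bar> \<le> c"
    using False assms(1) by (simp add: abs_mult)
  then have "u\<^sup>2 \<le> c\<^sup>2"
    using abs_le_square_iff[of u c] assms(2) by simp
  then have v2: "v\<^sup>2 = c\<^sup>2 - u\<^sup>2"
    by (simp add: v_def)
  have "(a - u)\<^sup>2 + v\<^sup>2 = b\<^sup>2"
    using ua unfolding v2 by (simp add: power2_eq_square algebra_simps)
  moreover have "u\<^sup>2 + v\<^sup>2 = c\<^sup>2"
    by (simp add: v2)
  ultimately show thesis
    using assms \<open>0 \<le> b\<close>
    by (intro that[of 0 "vector [a, 0]" "vector [u, v]"])
       (simp_all add: dist_norm norm_vec_def L2_set_def sum_2)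
qed

lemma dist_affine_combination_square:
  fixes p q r :: "'v::real_inner"
  shows "(dist ((1 - t) *\<^sub>R p + t *\<^sub>R q) r)\<^sup>2
    = (1 - t) * (dist p r)\<^sup>2 + t * (dist q r)\<^sup>2 - t * (1 - t) * (dist p q)\<^sup>2"
  unfolding dist_norm power2_norm_eq_inner
  by (simp add: inner_simps inner_commute algebra_simps power2_eq_square)

locale CAT0_space =
  fixes m :: "'a metric"
  assumes CAT0: "CAT0 m"
begin

abbreviation "X \<equiv> mspace m"
abbreviation "\<delta> \<equiv> mdist m"

sublocale Metric_space "mspace m" "mdist m"
  by (rule Metric_space_mspace_mdist)

lemma nonempty: "X \<noteq> {}"
  using CAT0 by (simp add: CAT0_def)

text \<open>Only comparisons between a point of one side and the opposite vertex are used: in the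
  plane, Stewart's identity \<open>dist_affine_combination_square\<close> computes the length of the cevian, so
  that comparison becomes an inequality without any reference to triangles. The point \<open>w\<close> is chosen before
  \<open>z\<close>, which is what makes uniqueness of geodesics follow.\<close>

lemma geodesic_point_exists:
  assumes x: "x \<in> X" and y: "y \<in> X" and t: "0 \<le> t" "t \<le> 1"
  shows "\<exists>w\<in>X. \<delta> x w = t * \<delta> x y \<and> \<delta> w y = (1 - t) * \<delta> x y \<and>
    (\<forall>z\<in>X. (\<delta> w z)\<^sup>2 \<le> (1 - t) * (\<delta> x z)\<^sup>2 + t * (\<delta> y z)\<^sup>2 - t * (1 - t) * (\<delta> x y)\<^sup>2)"
proof -
  have geo: "\<exists>S. geodesic_segment m u v S" if "u \<in> X" "v \<in> X" for u v
    using CAT0 that by (simp add: CAT0_def geodesic_metric_def)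
  let ?D = "\<delta> x y"
  obtain c where c: "geodesic_path m x y c"
    using geo[OF x y] by (auto simp: geodesic_segment_def)
  have seg: "geodesic_segment m x y (c ` {0..?D})"
    using c by (auto simp: geodesic_segment_def)
  have tD: "t * ?D \<in> {0..?D}"
    using t by (auto simp: mult_left_le_one_le)
  have ends: "0 \<in> {0..?D}" "?D \<in> {0..?D}" by auto
  define w where "w = c (t * ?D)"
  have w: "w \<in> X" "\<delta> x w = t * ?D"
    using c tD ends unfolding geodesic_path_def w_def by auto
  have "\<delta> w y = \<bar>t * ?D - ?D\<bar>"
    using c tD ends unfolding geodesic_path_def w_def by metis
  then have wy: "\<delta> w y = (1 - t) * ?D"
    using tD by (simp add: algebra_simps)
  have "(\<delta> w z)\<^sup>2 \<le> (1 - t) * (\<delta> x z)\<^sup>2 + t * (\<delta> y z)\<^sup>2 - t * (1 - t) * ?D\<^sup>2" if z: "z \<in> X" for z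
  proof -
    obtain B where B: "geodesic_segment m y z B" using geo y z by blast
    obtain C where C: "geodesic_segment m z x C" using geo x z by blast
    have zC: "z \<in> C"
    proof -
      obtain e where "geodesic_path m z x e" "C = e ` {0..\<delta> z x}"
        using C by (auto simp: geodesic_segment_def)
      then show ?thesis by (auto simp: geodesic_path_def intro!: image_eqI[of _ _ 0])
    qed
    have tri: "\<bar>?D - \<delta> z x\<bar> \<le> \<delta> y z" "\<delta> y z \<le> ?D + \<delta> z x"
      using triangle[OF x z y] triangle[OF z y x] triangle[OF x y z] triangle[OF y x z]
      commute[of x z] commute[of x y] commute[of y z] by linarith+
    obtain p' q' r' :: "real^2" where
      tr: "dist p' q' = ?D" "dist q' r' = \<delta> y z" "dist r' p' = \<delta> z x"
      by (rule comparison_triangle_exists[OF _ _ tri]) auto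
    define w' where "w' = (1 - t) *\<^sub>R p' + t *\<^sub>R q'"
    let ?T = "comparison_side m (c ` {0..?D}) x p' q' \<union> comparison_side m B y q' r' \<union>
                comparison_side m C z r' p'"
    have "p' - w' = t *\<^sub>R (p' - q')"
      by (simp add: w'_def algebra_simps)
    then have "dist p' w' = t * ?D"
      unfolding tr(1)[symmetric] using t by (simp add: dist_norm)
    then have "(w, w') \<in> ?T"
      using t tD w by (auto simp: comparison_side_def w_def w'_def closed_segment_def)
    moreover have "(z, r') \<in> ?T"
      using zC z by (auto simp: comparison_side_def)
    ultimately have "\<delta> w z \<le> dist w' r'"
      using CAT0 x y z seg B C tr unfolding CAT0_def Let_def by blast
    then have "(\<delta> w z)\<^sup>2 \<le> (dist w' r')\<^sup>2"
      by (intro power_mono) auto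
    also have "\<dots> = (1 - t) * (\<delta> x z)\<^sup>2 + t * (\<delta> y z)\<^sup>2 - t * (1 - t) * ?D\<^sup>2"
      unfolding w'_def dist_affine_combination_square
      using tr by (simp add: dist_commute[of p' r'] commute[of x z])
    finally show ?thesis .
  qed
  with w wy show ?thesis by blast
qed

definition geod :: "real \<Rightarrow> 'a \<Rightarrow> 'a \<Rightarrow> 'a" where
  "geod t x y = (SOME w. w \<in> X \<and> \<delta> x w = t * \<delta> x y \<and> \<delta> w y = (1 - t) * \<delta> x y)"

lemma
  assumes "x \<in> X" "y \<in> X" "0 \<le> t" "t \<le> 1"
  shows geod_in [simp]: "geod t x y \<in> X"
    and dist_geod_left: "\<delta> x (geod t x y) = t * \<delta> x y"
    and dist_geod_right: "\<delta> (geod t x y) y = (1 - t) * \<delta> x y"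
proof -
  have "\<exists>w. w \<in> X \<and> \<delta> x w = t * \<delta> x y \<and> \<delta> w y = (1 - t) * \<delta> x y"
    using geodesic_point_exists[OF assms] by blast
  from someI_ex[OF this]
  show "geod t x y \<in> X" "\<delta> x (geod t x y) = t * \<delta> x y" "\<delta> (geod t x y) y = (1 - t) * \<delta> x y"
    unfolding geod_def by auto
qed

text \<open>Inserting a second candidate \<open>z\<close> into the inequality for \<open>w\<close> makes the right-hand side
  vanish, so that all candidates coincide with \<open>w\<close>.\<close>

lemma geodesic_point_unique:
  assumes x: "x \<in> X" and y: "y \<in> X" and t: "0 \<le> t" "t \<le> 1"
    and z: "z \<in> X" "\<delta> x z = t * \<delta> x y" "\<delta> z y = (1 - t) * \<delta> x y"
  shows "z = geod t x y"
proof -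
  obtain w where w: "w \<in> X"
    "\<And>z. z \<in> X \<Longrightarrow> (\<delta> w z)\<^sup>2 \<le> (1 - t) * (\<delta> x z)\<^sup>2 + t * (\<delta> y z)\<^sup>2 - t * (1 - t) * (\<delta> x y)\<^sup>2"
    using geodesic_point_exists[OF x y t] by blast
  have eq: "z = w" if z: "z \<in> X" "\<delta> x z = t * \<delta> x y" "\<delta> z y = (1 - t) * \<delta> x y" for z
  proof -
    have "(\<delta> w z)\<^sup>2 \<le> (1 - t) * (t * \<delta> x y)\<^sup>2 + t * ((1 - t) * \<delta> x y)\<^sup>2 - t * (1 - t) * (\<delta> x y)\<^sup>2"
      using w(2)[OF z(1)] z commute[of y z] by simp
    also have "\<dots> = 0"
      by (simp add: power2_eq_square algebra_simps)
    finally show ?thesis using w(1) z(1) by simp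
  qed
  show ?thesis
    using eq[OF z] eq[OF geod_in[OF x y t] dist_geod_left[OF x y t] dist_geod_right[OF x y t]] by simp
qed

text \<open>For \<open>t = 1/2\<close> this is the inequality of Bruhat and Tits. All further geometry of
  CAT(0) spaces is derived from it.\<close>

lemma CN_inequality:
  assumes "x \<in> X" "y \<in> X" "z \<in> X" "0 \<le> t" "t \<le> 1"
  shows "(\<delta> (geod t x y) z)\<^sup>2
    \<le> (1 - t) * (\<delta> x z)\<^sup>2 + t * (\<delta> y z)\<^sup>2 - t * (1 - t) * (\<delta> x y)\<^sup>2"
  using geodesic_point_exists[OF assms(1,2,4,5)] geodesic_point_unique[OF assms(1,2,4,5)] assms(3)
  by metis

lemma geod_0 [simp]: "x \<in> X \<Longrightarrow> y \<in> X \<Longrightarrow> geod 0 x y = x"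
  using geodesic_point_unique[of x y 0 x] by simp

lemma geod_1 [simp]: "x \<in> X \<Longrightarrow> y \<in> X \<Longrightarrow> geod 1 x y = y"
  using geodesic_point_unique[of x y 1 y] by simp

lemma geod_reverse:
  assumes "x \<in> X" "y \<in> X" "0 \<le> t" "t \<le> 1"
  shows "geod t x y = geod (1 - t) y x"
  using geodesic_point_unique[of y x "1 - t" "geod t x y"] assms
  by (simp add: dist_geod_left dist_geod_right commute[of y])
     (metis dist_geod_left dist_geod_right commute)

text \<open>\<open>CN_inequality\<close> is applied once to the point \<open>geod t x y\<close> and the geodesic from \<open>x\<close> to \<open>y'\<close>, and
  once to \<open>y'\<close> and the geodesic from \<open>x\<close> to \<open>y\<close>. The distances from \<open>x\<close> cancel.\<close>

lemma dist_geod_common_start: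
  assumes x: "x \<in> X" and y: "y \<in> X" "y' \<in> X" and t: "0 \<le> t" "t \<le> 1"
  shows "\<delta> (geod t x y) (geod t x y') \<le> t * \<delta> y y'"
proof -
  let ?u = "geod t x y" and ?v = "geod t x y'"
  have u: "?u \<in> X" using x y t by simp
  have 1: "(\<delta> ?v ?u)\<^sup>2 \<le> (1 - t) * (\<delta> x ?u)\<^sup>2 + t * (\<delta> y' ?u)\<^sup>2 - t * (1 - t) * (\<delta> x y')\<^sup>2"
    by (rule CN_inequality[OF x y(2) u t])
  have 2: "(\<delta> ?u y')\<^sup>2 \<le> (1 - t) * (\<delta> x y')\<^sup>2 + t * (\<delta> y y')\<^sup>2 - t * (1 - t) * (\<delta> x y)\<^sup>2"
    by (rule CN_inequality[OF x y t])
  have "(\<delta> ?v ?u)\<^sup>2 \<le> (1 - t) * (t * \<delta> x y)\<^sup>2 + t * (\<delta> ?u y')\<^sup>2 - t * (1 - t) * (\<delta> x y')\<^sup>2"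
    using 1 by (simp add: dist_geod_left x y t commute[of y'])
  also have "\<dots> \<le> (1 - t) * (t * \<delta> x y)\<^sup>2 +
     t * ((1 - t) * (\<delta> x y')\<^sup>2 + t * (\<delta> y y')\<^sup>2 - t * (1 - t) * (\<delta> x y)\<^sup>2) - t * (1 - t) * (\<delta> x y')\<^sup>2"
    using mult_left_mono[OF 2 t(1)] by linarith
  also have "\<dots> = (t * \<delta> y y')\<^sup>2"
    by (simp add: power2_eq_square algebra_simps)
  finally have "\<delta> ?v ?u \<le> t * \<delta> y y'"
    by (rule power2_le_imp_le) (simp add: t)
  then show ?thesis
    by (simp add: commute[of ?u])
qed

text \<open>Passing through the diagonal geodesic from \<open>x\<close> to \<open>y'\<close> reduces the claim to geodesics with a
  common endpoint.\<close>

lemma dist_geod_le: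
  assumes x: "x \<in> X" "x' \<in> X" and y: "y \<in> X" "y' \<in> X" and t: "0 \<le> t" "t \<le> 1"
  shows "\<delta> (geod t x y) (geod t x' y') \<le> \<delta> x x' + \<delta> y y'"
proof -
  have "\<delta> (geod t x y) (geod t x' y') \<le> \<delta> (geod t x y) (geod t x y') + \<delta> (geod t x y') (geod t x' y')"
    using assms by (intro triangle) auto
  moreover have "\<delta> (geod t x y) (geod t x y') \<le> t * \<delta> y y'"
    by (rule dist_geod_common_start[OF x(1) y t])
  moreover have "\<delta> (geod t x y') (geod t x' y') \<le> (1 - t) * \<delta> x x'"
    using dist_geod_common_start[OF y(2) x, of "1 - t"] t geod_reverse[of _ y' t] x y by simp
  moreover have "t * \<delta> y y' \<le> \<delta> y y'" "(1 - t) * \<delta> x x' \<le> \<delta> x x'"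
    using t by (auto simp: mult_left_le_one_le)
  ultimately show ?thesis by linarith
qed

lemma dist_geod_parameter_le:
  assumes x: "x \<in> X" and y: "y \<in> X" and s: "0 \<le> s" "s \<le> 1" and t: "0 \<le> t" "t \<le> 1"
  shows "\<delta> (geod s x y) (geod t x y) \<le> \<bar>s - t\<bar> * \<delta> x y"
proof (rule power2_le_imp_le)
  have "(\<delta> (geod s x y) (geod t x y))\<^sup>2
    \<le> (1 - s) * (t * \<delta> x y)\<^sup>2 + s * ((1 - t) * \<delta> x y)\<^sup>2 - s * (1 - s) * (\<delta> x y)\<^sup>2"
    using CN_inequality[OF x y geod_in[OF x y t] s] dist_geod_left[OF x y t] dist_geod_right[OF x y t]
    by (simp add: commute[of y])
  also have "\<dots> = (\<bar>s - t\<bar> * \<delta> x y)\<^sup>2"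
    by (simp add: power_mult_distrib) (simp add: power2_eq_square algebra_simps)
  finally show "(\<delta> (geod s x y) (geod t x y))\<^sup>2 \<le> (\<bar>s - t\<bar> * \<delta> x y)\<^sup>2" .
qed simp

lemma continuous_map_geod:
  assumes u: "continuous_map Z mtopology u" and v: "continuous_map Z mtopology v"
    and t: "continuous_map Z euclideanreal t" and t01: "\<And>z. z \<in> topspace Z \<Longrightarrow> t z \<in> {0..1}"
  shows "continuous_map Z mtopology (\<lambda>z. geod (t z) (u z) (v z))"
  unfolding continuous_map_to_metric
proof (intro ballI allI impI)
  fix z and \<epsilon> :: real
  assume z: "z \<in> topspace Z" and \<epsilon>: "\<epsilon> > 0"
  have uv: "u y \<in> X" "v y \<in> X" if "y \<in> topspace Z" for y
    using u v that by (auto simp: continuous_map_def)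
  define e where "e = \<epsilon> / 3"
  have e: "e > 0" using \<epsilon> by (simp add: e_def)
  obtain U where U: "openin Z U" "z \<in> U" "\<And>y. y \<in> U \<Longrightarrow> u y \<in> mball (u z) e"
    using u z e unfolding continuous_map_to_metric by metis
  obtain V where V: "openin Z V" "z \<in> V" "\<And>y. y \<in> V \<Longrightarrow> v y \<in> mball (v z) e"
    using v z e unfolding continuous_map_to_metric by metis
  define e' where "e' = e / (\<delta> (u z) (v z) + 1)"
  have pos: "\<delta> (u z) (v z) + 1 > 0"
    using nonneg[of "u z" "v z"] by linarith
  have e': "e' > 0" using e pos by (simp add: e'_def)
  have W: "openin Z {y \<in> topspace Z. t y \<in> ball (t z) e'}"
    using t by (intro openin_continuous_map_preimage) auto
  let ?W = "U \<inter> V \<inter> {y \<in> topspace Z. t y \<in> ball (t z) e'}"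
  show "\<exists>W. openin Z W \<and> z \<in> W \<and>
     (\<forall>y\<in>W. geod (t y) (u y) (v y) \<in> mball (geod (t z) (u z) (v z)) \<epsilon>)"
  proof (intro exI conjI ballI)
    show "openin Z ?W" using U V W by auto
    show "z \<in> ?W" using U V z e' by auto
    fix y assume y: "y \<in> ?W"
    then have yZ: "y \<in> topspace Z" by auto
    have tt: "0 \<le> t z" "t z \<le> 1" "0 \<le> t y" "t y \<le> 1"
      using t01[OF z] t01[OF yZ] by auto
    have "\<bar>t z - t y\<bar> * \<delta> (u z) (v z) \<le> e' * \<delta> (u z) (v z)"
      using y by (intro mult_right_mono) (auto simp: dist_real_def)
    also have "\<dots> \<le> e"
      using e pos by (simp add: e'_def field_simps)
    finally have 1: "\<delta> (geod (t z) (u z) (v z)) (geod (t y) (u z) (v z)) \<le> e"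
      using dist_geod_parameter_le[OF uv[OF z] tt] by simp
    have "\<delta> (geod (t y) (u z) (v z)) (geod (t y) (u y) (v y)) \<le> \<delta> (u z) (u y) + \<delta> (v z) (v y)"
      using uv z yZ tt by (intro dist_geod_le) auto
    then have 2: "\<delta> (geod (t y) (u z) (v z)) (geod (t y) (u y) (v y)) < e + e"
      using U(3)[of y] V(3)[of y] y by auto
    have "\<delta> (geod (t z) (u z) (v z)) (geod (t y) (u y) (v y)) < \<epsilon>"
      using triangle[of "geod (t z) (u z) (v z)" "geod (t y) (u z) (v z)" "geod (t y) (u y) (v y)"]
        1 2 uv z yZ tt by (simp add: e_def)
    then show "geod (t y) (u y) (v y) \<in> mball (geod (t z) (u z) (v z)) \<epsilon>"
      using uv z yZ tt by simp
  qed
qed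

definition geod_convex :: "'a set \<Rightarrow> bool" where
  "geod_convex C \<longleftrightarrow> C \<subseteq> X \<and> (\<forall>x\<in>C. \<forall>y\<in>C. \<forall>t\<in>{0..1}. geod t x y \<in> C)"

lemma geod_convexD: "geod_convex C \<Longrightarrow> x \<in> C \<Longrightarrow> y \<in> C \<Longrightarrow> 0 \<le> t \<Longrightarrow> t \<le> 1 \<Longrightarrow> geod t x y \<in> C"
  by (simp add: geod_convex_def)

end

section \<open>The Poincare-Miranda theorem\<close>

text \<open>The Hilbert cube stands for the cubes of all finite dimensions at once: a function on the
  \<open>n\<close>-cube is a function on \<open>hcube\<close> that depends on the coordinates below \<open>n\<close> only. In this way the
  dimension can be the subject of an induction.\<close>

definition hcube :: "(nat \<Rightarrow> real) set" where
  "hcube = {x. \<forall>i. x i \<in> {0..1}}"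

lemma compact_hcube: "compact hcube"
proof -
  have "compactin (product_topology (\<lambda>i::nat. euclideanreal) UNIV) (PiE UNIV (\<lambda>i. {0..1}))"
    by (simp add: compactin_PiE)
  moreover have "PiE UNIV (\<lambda>i::nat. {0..1}) = hcube"
    by (auto simp: hcube_def PiE_def Pi_def)
  ultimately show ?thesis
    by (simp add: euclidean_product_topology)
qed

lemma tendsto_fun_coordinatewise:
  fixes f :: "'b \<Rightarrow> nat \<Rightarrow> real"
  assumes "\<And>i. ((\<lambda>n. f n i) \<longlongrightarrow> l i) F"
  shows "(f \<longlongrightarrow> l) F"
proof -
  have "limitin (product_topology (\<lambda>i::nat. euclideanreal) UNIV) f l F"
    using assms by (simp add: limitin_componentwise)
  then show ?thesis by (simp add: euclidean_product_topology)
qed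

text \<open>Kuhn's lemma is applied to the grid of mesh \<open>1 / p\<close>, each vertex labelled in direction \<open>i\<close> by the
  sign of \<open>F i\<close>. It finds a small cube on which every \<open>F i\<close> takes both signs. A limit
  point of such cubes, for \<open>p\<close> tending to infinity, is a common zero.\<close>

proposition Poincare_Miranda:
  fixes F :: "nat \<Rightarrow> (nat \<Rightarrow> real) \<Rightarrow> real"
  assumes cont: "\<And>i. i < n \<Longrightarrow> continuous_on hcube (F i)"
    and lower: "\<And>i x. i < n \<Longrightarrow> x \<in> hcube \<Longrightarrow> x i = 0 \<Longrightarrow> F i x \<le> 0"
    and upper: "\<And>i x. i < n \<Longrightarrow> x \<in> hcube \<Longrightarrow> x i = 1 \<Longrightarrow> F i x \<ge> 0"
  shows "\<exists>x\<in>hcube. \<forall>i<n. F i x = 0"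
proof -
  define grid :: "nat \<Rightarrow> (nat \<Rightarrow> nat) \<Rightarrow> nat \<Rightarrow> real" where
    "grid p q i = (if i < n then real (q i) / real p else 0)" for p q i
  have grid_in: "grid p q \<in> hcube" if "0 < p" "\<forall>i<n. q i \<le> p" for p q
    using that by (auto simp: grid_def hcube_def)
  have "\<exists>q\<in>hcube. \<forall>i<n. \<exists>r s. r \<in> hcube \<and> s \<in> hcube \<and>
      (\<forall>j. \<bar>r j - q j\<bar> \<le> 1 / Suc k) \<and> (\<forall>j. \<bar>s j - q j\<bar> \<le> 1 / Suc k) \<and>
      F i r \<le> 0 \<and> F i s \<ge> 0" for k
  proof -
    define p where "p = Suc k"
    have p: "0 < p" by (simp add: p_def)
    \<comment> \<open>Since \<open>F i\<close> may vanish on the two faces, the label there is given by the position, as Kuhn's lemma requires.\<close>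
    define label :: "(nat \<Rightarrow> nat) \<Rightarrow> nat \<Rightarrow> nat" where
      "label x i = (if x i = p \<or> x i > 0 \<and> F i (grid p x) > 0 then 1 else 0)" for x i
    have label0: "F i (grid p x) \<le> 0" if "\<forall>i<n. x i \<le> p" "i < n" "label x i = 0" for x i
      using that lower[OF that(2) grid_in[OF p that(1)]]
      by (auto simp: label_def grid_def not_less split: if_splits)
    have label1: "F i (grid p x) \<ge> 0" if "\<forall>i<n. x i \<le> p" "i < n" "label x i = 1" for x i
      using that upper[OF that(2) grid_in[OF p that(1)]] p
      by (auto simp: label_def grid_def split: if_splits)
    obtain q where q: "\<forall>i<n. q i < p"
      and near: "\<forall>i<n. \<exists>r s. (\<forall>j<n. q j \<le> r j \<and> r j \<le> q j + 1) \<and>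
        (\<forall>j<n. q j \<le> s j \<and> s j \<le> q j + 1) \<and> label r i \<noteq> label s i"
      by (rule kuhn_lemma[of p n label, OF p]) (use p in \<open>auto simp: label_def\<close>)
    have close: "\<bar>grid p r j - grid p q j\<bar> \<le> 1 / p" if "\<forall>j<n. q j \<le> r j \<and> r j \<le> q j + 1" for r j
      using that p by (auto simp: grid_def diff_divide_distrib[symmetric] abs_mult divide_le_cancel)
    have r_le: "\<forall>j<n. r j \<le> p" if "\<forall>j<n. q j \<le> r j \<and> r j \<le> q j + 1" for r
      using that q by fastforce
    show ?thesis
      unfolding p_def[symmetric]
    proof (rule bexI[of _ "grid p q"], intro allI impI)
      show "grid p q \<in> hcube"
        using q by (intro grid_in p) (auto simp: less_imp_le)
      fix i assume i: "i < n"
      obtain r s where r: "\<forall>j<n. q j \<le> r j \<and> r j \<le> q j + 1"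
        and s: "\<forall>j<n. q j \<le> s j \<and> s j \<le> q j + 1" and "label r i \<noteq> label s i"
        using near i by blast
      then consider "label r i = 0" "label s i = 1" | "label r i = 1" "label s i = 0"
        by (auto simp: label_def split: if_splits)
      then show "\<exists>r s. r \<in> hcube \<and> s \<in> hcube \<and>
        (\<forall>j. \<bar>r j - grid p q j\<bar> \<le> 1 / p) \<and> (\<forall>j. \<bar>s j - grid p q j\<bar> \<le> 1 / p) \<and>
        F i r \<le> 0 \<and> F i s \<ge> 0"
      proof cases
        case 1
        show ?thesis
          by (rule exI[of _ "grid p r"], rule exI[of _ "grid p s"])
             (use 1 r s i in \<open>simp add: grid_in p close r_le label0 label1\<close>)
      next
        case 2
        show ?thesis
          by (rule exI[of _ "grid p s"], rule exI[of _ "grid p r"])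
             (use 2 r s i in \<open>simp add: grid_in p close r_le label0 label1\<close>)
      qed
    qed
  qed
  then have "\<forall>k. \<exists>q. q \<in> hcube \<and> (\<forall>i<n. \<exists>r s. r \<in> hcube \<and> s \<in> hcube \<and>
      (\<forall>j. \<bar>r j - q j\<bar> \<le> 1 / Suc k) \<and> (\<forall>j. \<bar>s j - q j\<bar> \<le> 1 / Suc k) \<and>
      F i r \<le> 0 \<and> F i s \<ge> 0)"
    by blast
  from choice[OF this] obtain q where q: "\<And>k. q k \<in> hcube"
    and ex: "\<And>k i. i < n \<Longrightarrow> \<exists>r s. r \<in> hcube \<and> s \<in> hcube \<and>
      (\<forall>j. \<bar>r j - q k j\<bar> \<le> 1 / Suc k) \<and> (\<forall>j. \<bar>s j - q k j\<bar> \<le> 1 / Suc k) \<and>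
      F i r \<le> 0 \<and> F i s \<ge> 0"
    by blast
  obtain x \<rho> where x: "x \<in> hcube" and \<rho>: "strict_mono \<rho>" and lim: "(q \<circ> \<rho>) \<longlonglongrightarrow> x"
    using compact_imp_seq_compact[OF compact_hcube] q unfolding seq_compact_def by metis
  have lim_near: "(u \<circ> \<rho>) \<longlonglongrightarrow> x" if "\<And>p j. \<bar>u p j - q p j\<bar> \<le> 1 / Suc p" for u
  proof (rule tendsto_fun_coordinatewise)
    fix j
    have "(\<lambda>p. (q \<circ> \<rho>) p j) \<longlonglongrightarrow> x j"
      by (rule continuous_on_tendsto_compose[OF continuous_on_product_coordinates lim]) auto
    moreover have "(\<lambda>p. (u \<circ> \<rho>) p j - (q \<circ> \<rho>) p j) \<longlonglongrightarrow> 0"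
    proof (rule Lim_null_comparison)
      show "\<forall>\<^sub>F p in sequentially. norm ((u \<circ> \<rho>) p j - (q \<circ> \<rho>) p j) \<le> inverse (real (Suc (\<rho> p)))"
        using that by (simp add: inverse_eq_divide)
      show "(\<lambda>p. inverse (real (Suc (\<rho> p)))) \<longlonglongrightarrow> 0"
        using LIMSEQ_subseq_LIMSEQ[OF LIMSEQ_inverse_real_of_nat \<rho>] by (simp add: o_def)
    qed
    ultimately show "(\<lambda>p. (u \<circ> \<rho>) p j) \<longlonglongrightarrow> x j"
      using tendsto_add by fastforce
  qed
  have "F i x = 0" if i: "i < n" for i
  proof -
    obtain r s where r: "\<And>k. r k \<in> hcube" "\<And>k j. \<bar>r k j - q k j\<bar> \<le> 1 / Suc k" "\<And>k. F i (r k) \<le> 0"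
      and s: "\<And>k. s k \<in> hcube" "\<And>k j. \<bar>s k j - q k j\<bar> \<le> 1 / Suc k" "\<And>k. F i (s k) \<ge> 0"
      using ex[OF i] by metis
    have lim_F: "(\<lambda>p. F i ((u \<circ> \<rho>) p)) \<longlonglongrightarrow> F i x"
      if "\<And>p. u p \<in> hcube" "\<And>p j. \<bar>u p j - q p j\<bar> \<le> 1 / Suc p" for u
      using that by (intro continuous_on_tendsto_compose[OF cont[OF i] lim_near]) (auto simp: x)
    have "F i x \<le> 0"
      by (rule LIMSEQ_le_const2[OF lim_F[of r]]) (use r in auto)
    moreover have "0 \<le> F i x"
      by (rule LIMSEQ_le_const[OF lim_F[of s]]) (use s in auto)
    ultimately show ?thesis by simp
  qed
  with x show ?thesis by blast
qed

section \<open>Fixed points of isometries of complete CAT(0) spaces\<close>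

context CAT0_space
begin

definition isometric :: "('a \<Rightarrow> 'a) \<Rightarrow> bool" where
  "isometric T \<longleftrightarrow> (\<forall>x\<in>X. T x \<in> X) \<and> (\<forall>x\<in>X. \<forall>y\<in>X. \<delta> (T x) (T y) = \<delta> x y)"

definition Fix :: "('a \<Rightarrow> 'a) set \<Rightarrow> 'a set" where
  "Fix S = {x \<in> X. \<forall>T\<in>S. T x = x}"

text \<open>An isometry that fixes \<open>x\<close> and \<open>y\<close> moves a point of the geodesic between them to a point at the same
  distances from \<open>x\<close> and \<open>y\<close>, and there is only one such point.\<close>

lemma geod_convex_Fix:
  assumes "\<And>T. T \<in> S \<Longrightarrow> isometric T"
  shows "geod_convex (Fix S)"
  unfolding geod_convex_def
proof (intro conjI ballI)
  show "Fix S \<subseteq> X" by (auto simp: Fix_def)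
  fix x y and t :: real assume xy: "x \<in> Fix S" "y \<in> Fix S" and t: "t \<in> {0..1}"
  have X: "x \<in> X" "y \<in> X" using xy by (auto simp: Fix_def)
  have g: "geod t x y \<in> X" using X t by simp
  have "T (geod t x y) = geod t x y" if T: "T \<in> S" for T
  proof -
    have iso: "isometric T" and fixed: "T x = x" "T y = y"
      using assms T xy by (auto simp: Fix_def)
    have "\<delta> x (T (geod t x y)) = \<delta> x (geod t x y)" "\<delta> (T (geod t x y)) y = \<delta> (geod t x y) y"
      using iso fixed X g unfolding isometric_def by metis+
    then show ?thesis
      using iso X g t
      by (intro geodesic_point_unique) (auto simp: isometric_def dist_geod_left dist_geod_right)
  qed
  then show "geod t x y \<in> Fix S" using g by (simp add: Fix_def)
qed

lemma closedin_Fix: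
  assumes "\<And>T. T \<in> S \<Longrightarrow> isometric T"
  shows "closedin mtopology (Fix S)"
  unfolding metric_closedin_iff_sequentially_closed
proof (intro conjI allI impI)
  show "Fix S \<subseteq> X" by (auto simp: Fix_def)
  fix \<sigma> l assume A: "range \<sigma> \<subseteq> Fix S \<and> limitin mtopology \<sigma> l sequentially"
  then have l: "l \<in> X" using limitin_mspace by blast
  have \<sigma>: "\<sigma> n \<in> X" "\<And>T. T \<in> S \<Longrightarrow> T (\<sigma> n) = \<sigma> n" for n
    using A by (auto simp: Fix_def)
  have "T l = l" if T: "T \<in> S" for T
  proof -
    have iso: "isometric T" by (rule assms[OF T])
    then have Tl: "T l \<in> X" using l by (simp add: isometric_def)
    have "\<delta> (\<sigma> n) (T l) = \<delta> (\<sigma> n) l" for n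
      using iso \<sigma>(1)[of n] \<sigma>(2)[OF T, of n] l unfolding isometric_def by metis
    then have "limitin mtopology \<sigma> (T l) sequentially"
      using A Tl by (simp add: limitin_metric_dist_null)
    then show ?thesis
      using A limitin_metric_unique trivial_limit_sequentially by blast
  qed
  then show "l \<in> Fix S" using l by (simp add: Fix_def)
qed

end

locale Hadamard_space = CAT0_space +
  assumes complete: "mcomplete"
begin

definition sum_sq_dist :: "'a set \<Rightarrow> 'a \<Rightarrow> real" where
  "sum_sq_dist F y = (\<Sum>a\<in>F. (\<delta> y a)\<^sup>2)"

text \<open>Uniform convexity: the value at the midpoint falls short of the mean of the values at the ends by a
  definite multiple of their squared distance. So minimising sequences are Cauchy.\<close>

lemma sum_sq_dist_midpoint:
  assumes F: "F \<subseteq> X" and x: "x \<in> X" and y: "y \<in> X"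
  shows "sum_sq_dist F (geod (1/2) x y)
    \<le> (sum_sq_dist F x + sum_sq_dist F y) / 2 - card F * (\<delta> x y)\<^sup>2 / 4"
proof -
  have "sum_sq_dist F (geod (1/2) x y) \<le> (\<Sum>a\<in>F. ((\<delta> x a)\<^sup>2 + (\<delta> y a)\<^sup>2) / 2 - (\<delta> x y)\<^sup>2 / 4)"
    unfolding sum_sq_dist_def
  proof (rule sum_mono)
    fix a assume "a \<in> F"
    then have "a \<in> X" using F by auto
    from CN_inequality[OF x y this, of "1/2"]
    show "(\<delta> (geod (1/2) x y) a)\<^sup>2 \<le> ((\<delta> x a)\<^sup>2 + (\<delta> y a)\<^sup>2) / 2 - (\<delta> x y)\<^sup>2 / 4"
      by (simp add: add_divide_distrib)
  qed
  also have "\<dots> = (sum_sq_dist F x + sum_sq_dist F y) / 2 - card F * (\<delta> x y)\<^sup>2 / 4"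
    by (simp add: sum_sq_dist_def sum_subtractf sum.distrib sum_divide_distrib[symmetric])
  finally show ?thesis .
qed

lemma tendsto_mdist:
  assumes "limitin mtopology \<sigma> l F" "\<forall>\<^sub>F n in F. \<sigma> n \<in> X" "a \<in> X"
  shows "((\<lambda>n. \<delta> (\<sigma> n) a) \<longlongrightarrow> \<delta> l a) F"
proof -
  have l: "l \<in> X" using assms(1) limitin_mspace by blast
  have "((\<lambda>n. \<delta> (\<sigma> n) a - \<delta> l a) \<longlongrightarrow> 0) F"
  proof (rule Lim_null_comparison)
    show "((\<lambda>n. \<delta> (\<sigma> n) l) \<longlongrightarrow> 0) F"
      using assms(1) by (simp add: limitin_metric_dist_null)
    have "norm (\<delta> x a - \<delta> l a) \<le> \<delta> x l" if "x \<in> X" for x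
      using triangle[OF that l assms(3)] triangle[OF l that assms(3)] commute[of x l]
      unfolding real_norm_def by linarith
    then show "\<forall>\<^sub>F n in F. norm (\<delta> (\<sigma> n) a - \<delta> l a) \<le> \<delta> (\<sigma> n) l"
      using assms(2) by (auto elim: eventually_mono)
  qed
  then show ?thesis
    by (rule LIM_zero_cancel)
qed

text \<open>For a singleton \<open>F\<close> the minimiser is the nearest-point projection onto \<open>C\<close>. For \<open>C = X\<close> it is the
  barycentre of \<open>F\<close>.\<close>

lemma unique_minimiser:
  assumes C: "closedin mtopology C" "geod_convex C" "C \<noteq> {}"
    and F: "F \<subseteq> X" "finite F" "F \<noteq> {}"
  shows "\<exists>!c. c \<in> C \<and> (\<forall>y\<in>C. sum_sq_dist F c \<le> sum_sq_dist F y)"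
proof -
  let ?f = "sum_sq_dist F"
  have CX: "C \<subseteq> X" using C(2) by (simp add: geod_convex_def)
  have k: "1 \<le> card F" using F by (simp add: Suc_leI card_gt_0_iff)
  have gap: "(\<delta> x y)\<^sup>2 \<le> 2 * ?f x + 2 * ?f y - 4 * b"
    if "x \<in> C" "y \<in> C" and b: "\<And>z. z \<in> C \<Longrightarrow> b \<le> ?f z" for x y b
  proof -
    have xy: "x \<in> X" "y \<in> X" using that CX by auto
    have "b \<le> ?f (geod (1/2) x y)"
      using that C(2) by (intro b geod_convexD) auto
    moreover have "(\<delta> x y)\<^sup>2 \<le> card F * (\<delta> x y)\<^sup>2"
      using k mult_right_mono[of 1 "real (card F)" "(\<delta> x y)\<^sup>2"] by simp
    ultimately have "b \<le> (?f x + ?f y) / 2 - (\<delta> x y)\<^sup>2 / 4"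
      using sum_sq_dist_midpoint[OF F(1) xy] by linarith
    then show ?thesis by (simp add: field_simps)
  qed
  define I where "I = Inf (?f ` C)"
  have bdd: "bdd_below (?f ` C)"
    by (rule bdd_belowI[of _ 0]) (auto simp: sum_sq_dist_def intro: sum_nonneg)
  have I_le: "I \<le> ?f z" if "z \<in> C" for z
    unfolding I_def using bdd that by (rule cINF_lower)
  have "\<exists>z\<in>C. ?f z < I + inverse (real (Suc n))" for n
    using cInf_lessD[of "?f ` C" "I + inverse (real (Suc n))"] C(3) by (auto simp: I_def)
  then obtain \<sigma> where \<sigma>: "\<And>n. \<sigma> n \<in> C" "\<And>n. ?f (\<sigma> n) < I + inverse (real (Suc n))"
    by metis
  have "MCauchy \<sigma>"
    unfolding MCauchy_def
  proof (intro conjI allI impI)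
    show "range \<sigma> \<subseteq> X" using \<sigma>(1) CX by auto
    fix \<epsilon> :: real assume \<epsilon>: "\<epsilon> > 0"
    obtain N where N: "inverse (real (Suc N)) < \<epsilon>\<^sup>2 / 4"
      using reals_Archimedean[of "\<epsilon>\<^sup>2 / 4"] \<epsilon> by auto
    show "\<exists>N. \<forall>n n'. N \<le> n \<longrightarrow> N \<le> n' \<longrightarrow> \<delta> (\<sigma> n) (\<sigma> n') < \<epsilon>"
    proof (intro exI[of _ N] allI impI)
      fix n n' assume n: "N \<le> n" "N \<le> n'"
      have "inverse (real (Suc k)) \<le> inverse (real (Suc N))" if "N \<le> k" for k
        using that by (intro le_imp_inverse_le) auto
      note this[OF n(1)] this[OF n(2)]
      moreover have "(\<delta> (\<sigma> n) (\<sigma> n'))\<^sup>2 \<le> 2 * ?f (\<sigma> n) + 2 * ?f (\<sigma> n') - 4 * I"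
        by (rule gap) (use \<sigma>(1) I_le in auto)
      ultimately have "(\<delta> (\<sigma> n) (\<sigma> n'))\<^sup>2 < \<epsilon>\<^sup>2"
        using \<sigma>(2)[of n] \<sigma>(2)[of n'] N by linarith
      then show "\<delta> (\<sigma> n) (\<sigma> n') < \<epsilon>"
        by (rule power_less_imp_less_base) (use \<epsilon> in simp)
    qed
  qed
  then obtain c where c: "limitin mtopology \<sigma> c sequentially"
    using complete unfolding mcomplete_def by blast
  have cC: "c \<in> C"
    by (rule limitin_closedin[OF c C(1)]) (use \<sigma>(1) in auto)
  have "(\<lambda>n. ?f (\<sigma> n)) \<longlonglongrightarrow> ?f c"
    unfolding sum_sq_dist_def
    using \<sigma>(1) CX F(1) by (intro tendsto_sum tendsto_power tendsto_mdist[OF c] always_eventually) auto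
  moreover have "(\<lambda>n. I + inverse (real (Suc n))) \<longlonglongrightarrow> I + 0"
    by (intro tendsto_add tendsto_const LIMSEQ_inverse_real_of_nat)
  ultimately have "?f c \<le> I + 0"
    by (rule LIMSEQ_le) (use \<sigma>(2) in \<open>auto intro: less_imp_le\<close>)
  then have min: "?f c \<le> ?f y" if "y \<in> C" for y
    using I_le[OF that] by simp
  have "c' = c" if "c' \<in> C" "\<forall>y\<in>C. ?f c' \<le> ?f y" for c'
  proof -
    have "?f c' \<le> ?f c" "?f c \<le> ?f c'" using that cC min by auto
    then have "(\<delta> c' c)\<^sup>2 \<le> 0"
      using gap[OF that(1) cC min] by simp
    moreover have "c' \<in> X" "c \<in> X" using that cC CX by auto
    ultimately show ?thesis by simp
  qed
  with cC min show ?thesis by blast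
qed

text \<open>The isometry \<open>T\<close> permutes the finite set \<open>F\<close>, so \<open>T c\<close> has the same sum of squared
  distances to \<open>F\<close> as \<open>c\<close>, and uniqueness applies.\<close>

lemma minimiser_fixed:
  assumes T: "isometric T" and F: "finite F" "F \<subseteq> X" "T ` F \<subseteq> F"
    and c: "c \<in> C" "\<And>y. y \<in> C \<Longrightarrow> sum_sq_dist F c \<le> sum_sq_dist F y"
    and uniq: "\<exists>!c. c \<in> C \<and> (\<forall>y\<in>C. sum_sq_dist F c \<le> sum_sq_dist F y)"
    and C: "C \<subseteq> X" "T c \<in> C"
  shows "T c = c"
proof -
  have inj: "inj_on T F"
  proof (rule inj_onI)
    fix x y assume "x \<in> F" "y \<in> F" "T x = T y"
    then have "\<delta> x y = \<delta> (T y) (T y)" "x \<in> X" "y \<in> X" "T y \<in> X"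
      using T F(2) unfolding isometric_def by (metis subsetD)+
    then show "x = y" by simp
  qed
  have "T ` F = F"
    by (rule card_subset_eq[OF F(1,3)]) (simp add: card_image inj)
  then have "sum_sq_dist F (T c) = (\<Sum>a\<in>T ` F. (\<delta> (T c) a)\<^sup>2)"
    by (simp add: sum_sq_dist_def)
  also have "\<dots> = (\<Sum>a\<in>F. (\<delta> (T c) (T a))\<^sup>2)"
    by (simp add: sum.reindex inj)
  also have "\<dots> = sum_sq_dist F c"
    unfolding sum_sq_dist_def
    using T F(2) c(1) C(1) by (intro sum.cong) (auto simp: isometric_def subset_iff)
  finally have "\<forall>y\<in>C. sum_sq_dist F (T c) \<le> sum_sq_dist F y"
    using c by simp
  then show ?thesis using uniq c C(2) by blast
qed

proposition torsion_has_fixed_point: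
  assumes T: "isometric T" and x: "x \<in> X" and n: "n > 0" "(T ^^ n) x = x"
  shows "Fix {T} \<noteq> {}"
proof -
  define F where "F = (\<lambda>k. (T ^^ k) x) ` {..<n}"
  have pow: "(T ^^ k) x \<in> X" for k
    by (induction k) (use T x in \<open>auto simp: isometric_def\<close>)
  have F: "finite F" "F \<subseteq> X" "F \<noteq> {}"
    using pow n by (auto simp: F_def)
  have "T ((T ^^ k) x) \<in> F" if "k < n" for k
  proof (cases "Suc k = n")
    case True
    then have "T ((T ^^ k) x) = (T ^^ 0) x" using n(2) by auto
    then show ?thesis using n(1) unfolding F_def by (intro image_eqI) auto
  next
    case False
    then show ?thesis using that by (auto simp: F_def intro!: image_eqI[of _ _ "Suc k"])
  qed
  then have TF: "T ` F \<subseteq> F" by (auto simp: F_def)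
  have X: "closedin mtopology X" "geod_convex X"
    by (auto simp: geod_convex_def)
  note uniq = unique_minimiser[OF X nonempty F(2,1,3)]
  then obtain c where c: "c \<in> X" "\<And>y. y \<in> X \<Longrightarrow> sum_sq_dist F c \<le> sum_sq_dist F y"
    by blast
  have "T c = c"
    by (rule minimiser_fixed[OF T F(1,2) TF c uniq]) (use T c in \<open>auto simp: isometric_def\<close>)
  then show ?thesis using c(1) by (auto simp: Fix_def)
qed

text \<open>Project a fixed point \<open>y\<close> of \<open>R\<close> to \<open>Fix S\<close>. The elements of \<open>R\<close> map \<open>Fix S\<close> to itself, because they
  commute with \<open>S\<close>, and they fix \<open>y\<close>; so they fix the projection.\<close>

lemma Fix_commuting_nonempty:
  assumes S: "\<And>T. T \<in> S \<Longrightarrow> isometric T" and R: "\<And>T. T \<in> R \<Longrightarrow> isometric T"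
    and comm: "\<And>T U x. T \<in> S \<Longrightarrow> U \<in> R \<Longrightarrow> x \<in> X \<Longrightarrow> T (U x) = U (T x)"
    and ne: "Fix S \<noteq> {}" "Fix R \<noteq> {}"
  shows "Fix (S \<union> R) \<noteq> {}"
proof -
  obtain y where y: "y \<in> Fix R" using ne(2) by blast
  have yX: "{y} \<subseteq> X" using y by (simp add: Fix_def)
  note uniq = unique_minimiser[OF closedin_Fix[OF S] geod_convex_Fix[OF S] ne(1) yX]
  then obtain c where c: "c \<in> Fix S"
    "\<And>z. z \<in> Fix S \<Longrightarrow> sum_sq_dist {y} c \<le> sum_sq_dist {y} z"
    by blast
  have "U c = c" if U: "U \<in> R" for U
  proof (rule minimiser_fixed[OF R[OF U] _ yX _ c uniq])
    show "U ` {y} \<subseteq> {y}" using y U by (simp add: Fix_def)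
    have "T (U c) = U c" if "T \<in> S" for T
      using comm[OF that U, of c] c(1) that unfolding Fix_def by force
    then show "U c \<in> Fix S"
      using R[OF U] c(1) by (simp add: Fix_def isometric_def)
  qed (auto simp: Fix_def)
  then have "c \<in> Fix (S \<union> R)" using c(1) by (auto simp: Fix_def)
  then show ?thesis by blast
qed

lemma Fix_UN_commuting_nonempty:
  assumes "finite J"
    and iso: "\<And>i T. i \<in> J \<Longrightarrow> T \<in> S i \<Longrightarrow> isometric T"
    and comm: "\<And>i j T U x. i \<in> J \<Longrightarrow> j \<in> J \<Longrightarrow> i \<noteq> j \<Longrightarrow>
      T \<in> S i \<Longrightarrow> U \<in> S j \<Longrightarrow> x \<in> X \<Longrightarrow> T (U x) = U (T x)"
    and ne: "\<And>i. i \<in> J \<Longrightarrow> Fix (S i) \<noteq> {}"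
  shows "Fix (\<Union>i\<in>J. S i) \<noteq> {}"
  using assms
proof (induction J)
  case empty
  then show ?case using nonempty by (simp add: Fix_def)
next
  case (insert j J)
  have "Fix (S j \<union> (\<Union>i\<in>J. S i)) \<noteq> {}"
  proof (rule Fix_commuting_nonempty)
    show "Fix (\<Union>i\<in>J. S i) \<noteq> {}"
    proof (rule insert.IH)
      show "T (U x) = U (T x)"
        if "i \<in> J" "k \<in> J" "i \<noteq> k" "T \<in> S i" "U \<in> S k" "x \<in> X" for i k T U x
        using insert.prems(2)[of i k T U x] that by blast
    qed (use insert.prems in auto)
    show "T (U x) = U (T x)" if "T \<in> S j" "U \<in> (\<Union>i\<in>J. S i)" "x \<in> X" for T U x
      using that insert.hyps insert.prems(2)[of j _ T U x] by auto
  qed (use insert.prems in auto)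
  then show ?case by simp
qed

end

section \<open>Essential families of pairs of convex sets\<close>

context CAT0_space
begin

text \<open>A cube with the corners \<open>P \<epsilon>\<close> for \<open>\<epsilon> \<in> {False, True}^n\<close>: in the last coordinate, it
  interpolates geodesically between the fillings of the two opposite faces. The value of \<open>\<epsilon>\<close> at
  indices from \<open>n\<close> on is \<open>False\<close>.\<close>

primrec cubefill :: "nat \<Rightarrow> ((nat \<Rightarrow> bool) \<Rightarrow> 'a) \<Rightarrow> (nat \<Rightarrow> real) \<Rightarrow> 'a" where
  "cubefill 0 = (\<lambda>P x. P (\<lambda>_. False))"
| "cubefill (Suc n) = (\<lambda>P x. geod (x n)
     (cubefill n (\<lambda>\<epsilon>. P (\<epsilon>(n := False))) x) (cubefill n (\<lambda>\<epsilon>. P (\<epsilon>(n := True))) x))"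

lemma cubefill_in_convex:
  assumes "geod_convex C" "x \<in> hcube" "\<And>\<epsilon>. P \<epsilon> \<in> C"
  shows "cubefill n P x \<in> C"
  using assms(3)
proof (induction n arbitrary: P)
  case (Suc n)
  have "cubefill n (\<lambda>\<epsilon>. P (\<epsilon>(n := b))) x \<in> C" for b
    by (rule Suc.IH) (rule Suc.prems)
  then show ?case
    using assms(2) by (auto simp: hcube_def intro: geod_convexD[OF assms(1)])
qed simp

lemma geod_convex_space: "geod_convex X"
  by (auto simp: geod_convex_def)

text \<open>Both faces between which a later coordinate interpolates stay in \<open>C\<close>, hence so does the
  geodesic by convexity.\<close>

lemma cubefill_face:
  assumes C: "geod_convex C" and x: "x \<in> hcube" and P: "\<And>\<epsilon>. P \<epsilon> \<in> X"
    and j: "j < n" and xj: "x j = of_bool b" and PC: "\<And>\<epsilon>. \<epsilon> j = b \<Longrightarrow> P \<epsilon> \<in> C"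
  shows "cubefill n P x \<in> C"
  using P PC j
proof (induction n arbitrary: P)
  case (Suc n)
  have X: "cubefill n (\<lambda>\<epsilon>. P (\<epsilon>(n := c))) x \<in> X" for c
    by (rule cubefill_in_convex[OF geod_convex_space x]) (rule Suc.prems)
  show ?case
  proof (cases "j = n")
    case True
    have "cubefill n (\<lambda>\<epsilon>. P (\<epsilon>(n := b))) x \<in> C"
      by (rule cubefill_in_convex[OF C x]) (use Suc.prems(2) True in simp)
    then show ?thesis using X xj True by (cases b) auto
  next
    case False
    have "cubefill n (\<lambda>\<epsilon>. P (\<epsilon>(n := c))) x \<in> C" for c
      by (rule Suc.IH) (use Suc.prems False in auto)
    then show ?thesis using x by (auto simp: hcube_def intro!: geod_convexD[OF C])
  qed
qed simp

lemma continuous_map_cubefill: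
  assumes "\<And>\<epsilon>. P \<epsilon> \<in> X"
  shows "continuous_map (top_of_set hcube) mtopology (cubefill n P)"
  using assms
proof (induction n arbitrary: P)
  case 0
  then show ?case by simp
next
  case (Suc n)
  have "continuous_on hcube (\<lambda>x. x n)"
    by (rule continuous_on_product_then_coordinatewise) (rule continuous_on_id)
  then have "continuous_map (top_of_set hcube) euclideanreal (\<lambda>x. x n)"
    by simp
  then show ?case
    unfolding cubefill.simps
    by (intro continuous_map_geod Suc.IH Suc.prems) (auto simp: hcube_def)
qed

text \<open>In the language of dimension theory, disjoint pairs with the property \<open>corner\<close> would form an
  essential family: no partitions between the \<open>A i\<close> and the \<open>B i\<close> have empty intersection. A normal space
  of dimension less than \<open>d\<close> has no essential family of \<open>d\<close> pairs.\<close>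

proposition essential_pairs_meet:
  assumes dim: "covering_dim mtopology < enat d"
    and clo: "\<And>i. i < d \<Longrightarrow> closedin mtopology (A i)" "\<And>i. i < d \<Longrightarrow> closedin mtopology (B i)"
    and conv: "\<And>i. i < d \<Longrightarrow> geod_convex (A i)" "\<And>i. i < d \<Longrightarrow> geod_convex (B i)"
    and corner: "\<And>\<epsilon>. \<exists>p\<in>X. \<forall>i<d. p \<in> (if \<epsilon> i then B i else A i)"
  shows "\<exists>i<d. A i \<inter> B i \<noteq> {}"
proof (rule ccontr)
  assume "\<not> ?thesis"
  then have disj: "disjnt (A i) (B i)" if "i < d" for i
    using that by (auto simp: disjnt_def)
  obtain k where k: "covering_dim_le mtopology k" "k < d"
    using dim unfolding covering_dim_def Inf_less_iff by auto
  have "normal_space mtopology"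
    by (simp add: metrizable_imp_normal_space metrizable_space_mtopology)
  then have "\<exists>u. continuous_map mtopology (top_of_set {-1..1::real}) u \<and> u ` A i \<subseteq> {-1} \<and> u ` B i \<subseteq> {1}"
    if "i < d" for i
    by (rule Urysohn_lemma[of mtopology "A i" "B i" "-1" 1]) (use clo disj that in auto)
  then obtain u where u: "\<And>i. i < d \<Longrightarrow> continuous_map mtopology (top_of_set {-1..1::real}) (u i)"
    and uA: "\<And>i x. i < d \<Longrightarrow> x \<in> A i \<Longrightarrow> u i x = -1"
    and uB: "\<And>i x. i < d \<Longrightarrow> x \<in> B i \<Longrightarrow> u i x = 1"
    by (simp add: image_subset_iff) metis
  have u_real: "continuous_map mtopology euclideanreal (u i)" if "i < d" for i
    using u[OF that] by (simp add: continuous_map_in_subtopology)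
  define K where "K = (\<Union>i<d. A i \<union> B i)"
  have K: "closedin mtopology K"
    unfolding K_def by (intro closedin_Union) (auto intro: clo)
  define \<nu> where "\<nu> x = sqrt (\<Sum>i<d. (u i x)\<^sup>2)" for x
  have \<nu>_pos: "\<nu> x > 0" if x: "x \<in> K" for x
  proof -
    obtain i where i: "i < d" "x \<in> A i \<union> B i" using x by (auto simp: K_def)
    then have "(u i x)\<^sup>2 = 1" using uA uB by (auto simp: power2_eq_1_iff)
    moreover have "(u i x)\<^sup>2 \<le> (\<Sum>i<d. (u i x)\<^sup>2)"
      using i by (intro member_le_sum) auto
    ultimately show ?thesis by (simp add: \<nu>_def)
  qed
  \<comment> \<open>Outside \<open>K\<close> the norm \<open>\<nu>\<close> may vanish, so \<open>f\<close> maps only \<open>K\<close> to the sphere; the bound on the dimension provides an extension \<open>g\<close>.\<close>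
  define f where "f x i = (if i < d then u i x / \<nu> x else 0)" for x i
  obtain e where e: "d = Suc e" using k(2) by (cases d) auto
  have "continuous_map (subtopology mtopology K) (nsphere e) f"
    unfolding nsphere continuous_map_in_subtopology continuous_map_componentwise_UNIV
  proof (intro conjI allI)
    have u_K: "continuous_map (subtopology mtopology K) euclideanreal (u i)" if "i < d" for i
      by (rule continuous_map_from_subtopology[OF u_real[OF that]])
    have \<nu>_K: "continuous_map (subtopology mtopology K) euclideanreal \<nu>"
      unfolding \<nu>_def by (intro continuous_map_sqrt continuous_map_sum continuous_map_real_pow u_K) auto
    show "continuous_map (subtopology mtopology K) euclideanreal (\<lambda>x. f x i)" for i
    proof (cases "i < d")
      case True
      have "\<nu> x \<noteq> 0" if "x \<in> topspace (subtopology mtopology K)" for x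
        using \<nu>_pos[of x] that by auto
      with u_K[OF True] \<nu>_K have "continuous_map (subtopology mtopology K) euclideanreal (\<lambda>x. u i x / \<nu> x)"
        by (rule continuous_map_real_divide)
      then show ?thesis using True by (simp add: f_def)
    qed (simp add: f_def)
    have "(\<Sum>i\<le>e. (f x i)\<^sup>2) = 1" if "x \<in> K" for x
    proof -
      have "(\<Sum>i\<le>e. (f x i)\<^sup>2) = (\<Sum>i\<in>{..<d}. (u i x)\<^sup>2 / (\<nu> x)\<^sup>2)"
        by (rule sum.cong) (auto simp: f_def e power_divide)
      also have "\<dots> = (\<Sum>i<d. (u i x)\<^sup>2) / (\<nu> x)\<^sup>2"
        by (rule sum_divide_distrib[symmetric])
      also have "(\<Sum>i<d. (u i x)\<^sup>2) = (\<nu> x)\<^sup>2"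
        unfolding \<nu>_def by (rule real_sqrt_pow2[symmetric]) (simp add: sum_nonneg)
      also have "(\<nu> x)\<^sup>2 / (\<nu> x)\<^sup>2 = 1"
        using \<nu>_pos[OF that] by simp
      finally show ?thesis .
    qed
    then show "f \<in> topspace (subtopology mtopology K) \<rightarrow> {x. (\<Sum>i\<le>e. (x i)\<^sup>2) = 1 \<and> (\<forall>i>e. x i = 0)}"
      by (auto simp: f_def e)
  qed
  then obtain g where g: "continuous_map mtopology (nsphere e) g" and gf: "\<And>x. x \<in> K \<Longrightarrow> g x = f x"
    using k K unfolding covering_dim_le_def e less_Suc_eq_le by metis
  obtain P where P: "\<And>\<epsilon>. P \<epsilon> \<in> X" "\<And>\<epsilon> i. i < d \<Longrightarrow> P \<epsilon> \<in> (if \<epsilon> i then B i else A i)"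
    using corner by metis
  have PA: "P \<epsilon> \<in> A i" if "i < d" "\<not> \<epsilon> i" for \<epsilon> i
    using P(2)[OF that(1), of \<epsilon>] that(2) by simp
  have PB: "P \<epsilon> \<in> B i" if "i < d" "\<epsilon> i" for \<epsilon> i
    using P(2)[OF that(1), of \<epsilon>] that(2) by simp
  define h where "h = cubefill d P"
  have h: "continuous_map (top_of_set hcube) mtopology h"
    unfolding h_def by (rule continuous_map_cubefill[OF P(1)])
  have hX: "h x \<in> X" if "x \<in> hcube" for x
    using cubefill_in_convex[OF geod_convex_space that P(1)] by (simp add: h_def)
  have hA: "h x \<in> A i" if "i < d" "x \<in> hcube" "x i = 0" for i x
    unfolding h_def
    by (rule cubefill_face[where b = False, OF conv(1)[OF that(1)] that(2) P(1) that(1)])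
       (use that PA in auto)
  have hB: "h x \<in> B i" if "i < d" "x \<in> hcube" "x i = 1" for i x
    unfolding h_def
    by (rule cubefill_face[where b = True, OF conv(2)[OF that(1)] that(2) P(1) that(1)])
       (use that PB in auto)
  have "\<exists>x\<in>hcube. \<forall>i<d. g (h x) i = 0"
  proof (rule Poincare_Miranda)
    fix i assume i: "i < d"
    have "continuous_map (top_of_set hcube) euclideanreal ((\<lambda>y. y i) \<circ> (g \<circ> h))"
      by (rule continuous_map_compose[OF continuous_map_compose[OF h g] continuous_map_nsphere_projection])
    then show "continuous_on hcube (\<lambda>x. g (h x) i)" by (simp add: o_def)
    show "g (h x) i \<le> 0" if "x \<in> hcube" "x i = 0" for x
    proof -
      have "h x \<in> A i" "h x \<in> K" using hA[OF i that] i by (auto simp: K_def)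
      then show ?thesis using i \<nu>_pos[of "h x"] by (simp add: gf f_def uA)
    qed
    show "g (h x) i \<ge> 0" if "x \<in> hcube" "x i = 1" for x
    proof -
      have "h x \<in> B i" "h x \<in> K" using hB[OF i that] i by (auto simp: K_def)
      then show ?thesis using i \<nu>_pos[of "h x"] by (simp add: gf f_def uB)
    qed
  qed
  then obtain x where x: "x \<in> hcube" "\<And>i. i < d \<Longrightarrow> g (h x) i = 0" by blast
  have "g (h x) \<in> topspace (nsphere e)"
    using g hX[OF x(1)] unfolding continuous_map_def by auto
  then have "(\<Sum>i\<le>e. (g (h x) i)\<^sup>2) = 1"
    by (simp add: nsphere)
  moreover have "(\<Sum>i\<le>e. (g (h x) i)\<^sup>2) = 0"
    using x(2) by (intro sum.neutral) (simp add: e)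
  ultimately show False by simp
qed

end

section \<open>Commuting families of isometries\<close>

context Hadamard_space
begin

text \<open>Enumerate \<open>S\<close>: the fixed set of an initial segment is the whole space at the start and empty at
  the end. \<open>T\<close> is the element at which it becomes empty, \<open>R\<close> the segment before \<open>T\<close>.\<close>

lemma Fix_empty_imp_disjoint_pair:
  assumes "finite S" "Fix S = {}" "\<And>T. T \<in> S \<Longrightarrow> Fix {T} \<noteq> {}"
  shows "\<exists>R\<subseteq>S. \<exists>T\<in>S. Fix R \<noteq> {} \<and> Fix R \<inter> Fix {T} = {}"
  using assms
proof (induction S)
  case empty
  then show ?case using nonempty by (simp add: Fix_def)
next
  case (insert T S)
  show ?case
  proof (cases "Fix S = {}")
    case True
    then have "\<exists>R\<subseteq>S. \<exists>T\<in>S. Fix R \<noteq> {} \<and> Fix R \<inter> Fix {T} = {}"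
      by (rule insert.IH) (use insert.prems(2) in auto)
    then show ?thesis by blast
  next
    case False
    moreover have "Fix S \<inter> Fix {T} = {}"
      using insert.prems(1) by (auto simp: Fix_def)
    ultimately show ?thesis by blast
  qed
qed

text \<open>This is the case \<open>k = 1\<close> of a bootstrap principle, in which every subset of cardinality at most \<open>k\<close>,
  instead of every single element, is supposed to have a fixed point. It is stated for arbitrary sets of isometries; for a group
  action it is applied to generating sets, as a group fixes exactly what its generators fix.\<close>

theorem some_commuting_family_has_fixed_point:
  assumes dim: "covering_dim mtopology < enat d"
    and fin: "\<And>i. i < d \<Longrightarrow> finite (S i)"
    and iso: "\<And>i T. i < d \<Longrightarrow> T \<in> S i \<Longrightarrow> isometric T"
    and single: "\<And>i T. i < d \<Longrightarrow> T \<in> S i \<Longrightarrow> Fix {T} \<noteq> {}"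
    and comm: "\<And>i j T U x. i < d \<Longrightarrow> j < d \<Longrightarrow> i \<noteq> j \<Longrightarrow>
      T \<in> S i \<Longrightarrow> U \<in> S j \<Longrightarrow> x \<in> X \<Longrightarrow> T (U x) = U (T x)"
  shows "\<exists>i<d. Fix (S i) \<noteq> {}"
proof (rule ccontr)
  assume none: "\<not> ?thesis"
  have "\<exists>R T. R \<subseteq> S i \<and> T \<in> S i \<and> Fix R \<noteq> {} \<and> Fix R \<inter> Fix {T} = {}" if "i < d" for i
  proof -
    have "Fix (S i) = {}" using none that by blast
    from Fix_empty_imp_disjoint_pair[OF fin[OF that] this single[OF that]]
    show ?thesis by blast
  qed
  then obtain R T where R: "\<And>i. i < d \<Longrightarrow> R i \<subseteq> S i" "\<And>i. i < d \<Longrightarrow> Fix (R i) \<noteq> {}"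
    and T: "\<And>i. i < d \<Longrightarrow> T i \<in> S i"
    and disj: "\<And>i. i < d \<Longrightarrow> Fix (R i) \<inter> Fix {T i} = {}"
    by metis
  have isoR: "isometric U" if "i < d" "U \<in> R i" for i U
    using iso[OF that(1)] R(1)[OF that(1)] that(2) by blast
  have isoT: "isometric U" if "i < d" "U \<in> {T i}" for i U
    using iso[OF that(1)] T[OF that(1)] that(2) by blast
  have "\<exists>i<d. Fix (R i) \<inter> Fix {T i} \<noteq> {}"
  proof (rule essential_pairs_meet[OF dim])
    fix \<epsilon> :: "nat \<Rightarrow> bool"
    define Q where "Q i = (if \<epsilon> i then {T i} else R i)" for i
    have QS: "Q i \<subseteq> S i" if "i < d" for i
      using R(1) T that by (auto simp: Q_def)
    have "Fix (\<Union>i\<in>{..<d}. Q i) \<noteq> {}"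
    proof (rule Fix_UN_commuting_nonempty)
      show "Fix (Q i) \<noteq> {}" if "i \<in> {..<d}" for i
        using that R(2) single T by (auto simp: Q_def)
      show "isometric U" if "i \<in> {..<d}" "U \<in> Q i" for i U
        using iso QS that by blast
      show "U (V x) = V (U x)"
        if "i \<in> {..<d}" "j \<in> {..<d}" "i \<noteq> j" "U \<in> Q i" "V \<in> Q j" "x \<in> X" for i j U V x
        using comm[of i j U V x] QS that by blast
    qed simp
    then obtain p where "p \<in> Fix (\<Union>i\<in>{..<d}. Q i)" by blast
    then have "p \<in> X" "\<forall>i<d. p \<in> Fix (Q i)"
      by (auto simp: Fix_def)
    then show "\<exists>p\<in>X. \<forall>i<d. p \<in> (if \<epsilon> i then Fix {T i} else Fix (R i))"
      unfolding Q_def by (metis (full_types))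
  qed (intro closedin_Fix geod_convex_Fix isoR isoT; assumption)+
  then show False using disj by blast
qed

end

section \<open>Actions of direct products\<close>

definition factor_embedding :: "'i set \<Rightarrow> ('i \<Rightarrow> ('g, 'b) monoid_scheme) \<Rightarrow> 'i \<Rightarrow> 'g \<Rightarrow> 'i \<Rightarrow> 'g" where
  "factor_embedding I G i s = (\<lambda>j\<in>I. if j = i then s else \<one>\<^bsub>G j\<^esub>)"

context
  fixes I :: "'i set" and G :: "'i \<Rightarrow> ('g, 'b) monoid_scheme"
  assumes groups: "\<And>i. i \<in> I \<Longrightarrow> group (G i)"
begin

lemma factor_embedding_in:
  assumes "i \<in> I" "s \<in> carrier (G i)"
  shows "factor_embedding I G i s \<in> carrier (product_group I G)"
  using assms groups by (auto simp: factor_embedding_def group.is_monoid)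

lemma factor_embedding_hom:
  assumes "i \<in> I"
  shows "factor_embedding I G i \<in> hom (G i) (product_group I G)"
proof (rule homI)
  show "factor_embedding I G i (s \<otimes>\<^bsub>G i\<^esub> t) =
      factor_embedding I G i s \<otimes>\<^bsub>product_group I G\<^esub> factor_embedding I G i t" for s t
    using groups by (auto simp: factor_embedding_def fun_eq_iff restrict_def group.is_monoid)
qed (rule factor_embedding_in[OF assms])

lemma factor_embeddings_commute:
  assumes "i \<in> I" "j \<in> I" "i \<noteq> j" "s \<in> carrier (G i)" "t \<in> carrier (G j)"
  shows "factor_embedding I G i s \<otimes>\<^bsub>product_group I G\<^esub> factor_embedding I G j t
    = factor_embedding I G j t \<otimes>\<^bsub>product_group I G\<^esub> factor_embedding I G i s"
  using assms groups
  by (auto simp: factor_embedding_def fun_eq_iff restrict_def group.is_monoid)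

lemma factor_subgroup_eq_embedding:
  assumes "i \<in> I"
  shows "factor_subgroup I G i = factor_embedding I G i ` carrier (G i)"
proof
  show "factor_subgroup I G i \<subseteq> factor_embedding I G i ` carrier (G i)"
  proof
    fix x assume x: "x \<in> factor_subgroup I G i"
    then have "x = factor_embedding I G i (x i)" "x i \<in> carrier (G i)"
      using assms
      by (auto simp: factor_subgroup_def factor_embedding_def fun_eq_iff restrict_def PiE_iff extensional_def)
    then show "x \<in> factor_embedding I G i ` carrier (G i)" by blast
  qed
  show "factor_embedding I G i ` carrier (G i) \<subseteq> factor_subgroup I G i"
  proof (rule image_subsetI)
    fix s assume "s \<in> carrier (G i)"
    from factor_embedding_in[OF assms this] show "factor_embedding I G i s \<in> factor_subgroup I G i"
      unfolding factor_subgroup_def by (auto simp: factor_embedding_def)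
  qed
qed

end

lemma (in CAT0_space) isometric_action:
  assumes G: "group G" and \<phi>: "\<phi> \<in> hom G (isometry_group m)"
  shows "\<And>g. g \<in> carrier G \<Longrightarrow> isometric (\<phi> g)"
    and "\<And>g h x. g \<in> carrier G \<Longrightarrow> h \<in> carrier G \<Longrightarrow> x \<in> X \<Longrightarrow> \<phi> (g \<otimes>\<^bsub>G\<^esub> h) x = \<phi> g (\<phi> h x)"
    and "\<And>x. x \<in> X \<Longrightarrow> \<phi> \<one>\<^bsub>G\<^esub> x = x"
proof -
  interpret group G by (rule G)
  have Bij: "\<phi> g \<in> Bij X" and dist: "x \<in> X \<Longrightarrow> y \<in> X \<Longrightarrow> \<delta> (\<phi> g x) (\<phi> g y) = \<delta> x y"
    if "g \<in> carrier G" for g x y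
    using hom_in_carrier[OF \<phi> that] by (auto simp: isometry_group_def)
  have in_X: "\<phi> g x \<in> X" if "g \<in> carrier G" "x \<in> X" for g x
    using Bij[OF that(1)] that(2) by (auto simp: Bij_def bij_betw_def)
  show "isometric (\<phi> g)" if "g \<in> carrier G" for g
    using that in_X dist by (simp add: isometric_def)
  show mult: "\<phi> (g \<otimes>\<^bsub>G\<^esub> h) x = \<phi> g (\<phi> h x)" if "g \<in> carrier G" "h \<in> carrier G" "x \<in> X" for g h x
    using hom_mult[OF \<phi> that(1,2)] Bij that
    by (simp add: isometry_group_def BijGroup_def compose_def)
  show "\<phi> \<one>\<^bsub>G\<^esub> x = x" if "x \<in> X" for x
  proof -
    have "\<phi> \<one>\<^bsub>G\<^esub> (\<phi> \<one>\<^bsub>G\<^esub> x) = \<phi> \<one>\<^bsub>G\<^esub> x"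
      using mult[of "\<one>\<^bsub>G\<^esub>" "\<one>\<^bsub>G\<^esub>" x] that by simp
    \<comment> \<open>A homomorphism maps \<open>\<one>\<close> to an idempotent map, and an injective idempotent map is the identity.\<close>
    moreover have "inj_on (\<phi> \<one>\<^bsub>G\<^esub>) X"
      using Bij by (auto simp: Bij_def bij_betw_def)
    ultimately show ?thesis
      using in_X that by (auto dest: inj_onD)
  qed
qed

theorem proposition1:
  fixes d :: nat
    and \<Gamma> :: "nat \<Rightarrow> ('g, 'b) monoid_scheme"
    and m :: "'a metric"
    and \<phi> :: "(nat \<Rightarrow> 'g) \<Rightarrow> 'a \<Rightarrow> 'a"
  assumes "d \<ge> 1"
    and "\<And>i. i \<in> {1..d} \<Longrightarrow> group (\<Gamma> i)"
    and "\<And>i. i \<in> {1..d} \<Longrightarrow> fin_gen_by_torsion (\<Gamma> i)"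
    and "CAT0 m"
    and "mcomplete_of m"
    and "covering_dim (mtopology_of m) < enat d"
    and "\<phi> \<in> hom (product_group {1..d} \<Gamma>) (isometry_group m)"
  shows "\<exists>i\<in>{1..d}. has_fixed_point m \<phi> (factor_subgroup {1..d} \<Gamma> i)"
proof -
  interpret CAT0_space m by unfold_locales (rule assms)
  interpret Hadamard_space m
    by unfold_locales (use assms(5) in \<open>simp add: mcomplete_of_def\<close>)
  let ?I = "{1..d}" and ?P = "product_group {1..d} \<Gamma>"
  let ?emb = "factor_embedding {1..d} \<Gamma>"
  have grp: "group (\<Gamma> i)" if "i \<in> ?I" for i by (rule assms(2)[OF that])
  interpret P: group ?P by (rule product_group[OF grp])
  note action = isometric_action[OF P.is_group assms(7)]
  note emb_in = factor_embedding_in[where I = ?I and G = \<Gamma>, OF grp]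
  note emb_hom = factor_embedding_hom[where I = ?I and G = \<Gamma>, OF grp]
  have "\<exists>S. finite S \<and> S \<subseteq> carrier (\<Gamma> i) \<and> generate (\<Gamma> i) S = carrier (\<Gamma> i) \<and>
      (\<forall>s\<in>S. \<exists>n::nat. n > 0 \<and> s [^]\<^bsub>\<Gamma> i\<^esub> n = \<one>\<^bsub>\<Gamma> i\<^esub>)" if "i \<in> ?I" for i
    using assms(3)[OF that] by (simp add: fin_gen_by_torsion_def)
  then obtain S where fin: "\<And>i. i \<in> ?I \<Longrightarrow> finite (S i)"
    and sub: "\<And>i. i \<in> ?I \<Longrightarrow> S i \<subseteq> carrier (\<Gamma> i)"
    and gen: "\<And>i. i \<in> ?I \<Longrightarrow> generate (\<Gamma> i) (S i) = carrier (\<Gamma> i)"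
    and tors: "\<And>i s. i \<in> ?I \<Longrightarrow> s \<in> S i \<Longrightarrow> \<exists>n::nat. n > 0 \<and> s [^]\<^bsub>\<Gamma> i\<^esub> n = \<one>\<^bsub>\<Gamma> i\<^esub>"
    by metis
  \<comment> \<open>The factors are numbered from \<open>1\<close>, the coordinates of the cube from \<open>0\<close>.\<close>
  define R where "R i = (\<lambda>s. \<phi> (?emb (Suc i) s)) ` S (Suc i)" for i
  have SucI: "Suc i \<in> ?I" if "i < d" for i using that by simp
  have in_P: "?emb (Suc i) s \<in> carrier ?P" if "i < d" "s \<in> S (Suc i)" for i s
    using emb_in[OF _ SucI[OF that(1)]] sub[OF SucI[OF that(1)]] that(2) by blast
  have "\<exists>i<d. Fix (R i) \<noteq> {}"
  proof (rule some_commuting_family_has_fixed_point)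
    show "covering_dim mtopology < enat d"
      using assms(6) by (simp add: mtopology_of_def)
    show "finite (R i)" if "i < d" for i
      using fin[OF SucI[OF that]] by (simp add: R_def)
    show "isometric T" if "i < d" "T \<in> R i" for i T
      using that action(1) in_P by (auto simp: R_def)
    show "Fix {T} \<noteq> {}" if iT: "i < d" "T \<in> R i" for i T
    proof -
      obtain s where s: "s \<in> S (Suc i)" and T: "T = \<phi> (?emb (Suc i) s)"
        using iT by (auto simp: R_def)
      obtain n :: nat where n: "n > 0" "s [^]\<^bsub>\<Gamma> (Suc i)\<^esub> n = \<one>\<^bsub>\<Gamma> (Suc i)\<^esub>"
        using tors[OF SucI[OF iT(1)] s] by blast
      interpret \<Gamma>i: group "\<Gamma> (Suc i)" by (rule grp[OF SucI[OF iT(1)]])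
      interpret emb: group_hom "\<Gamma> (Suc i)" ?P "?emb (Suc i)"
        by unfold_locales (rule emb_hom[OF _ SucI[OF iT(1)]])
      have sC: "s \<in> carrier (\<Gamma> (Suc i))" using sub[OF SucI[OF iT(1)]] s by blast
      have pow: "(T ^^ k) x = \<phi> (?emb (Suc i) s [^]\<^bsub>?P\<^esub> k) x" if "x \<in> X" for k x
      proof (induction k)
        case 0
        show ?case by (simp only: P.nat_pow_0 funpow.simps id_apply action(3)[OF that])
      next
        case (Suc k)
        have "(T ^^ Suc k) x = \<phi> (?emb (Suc i) s \<otimes>\<^bsub>?P\<^esub> ?emb (Suc i) s [^]\<^bsub>?P\<^esub> k) x"
          using action(2)[OF _ _ that] Suc.IH in_P[OF iT(1) s] T P.nat_pow_closed by simp
        also have "?emb (Suc i) s \<otimes>\<^bsub>?P\<^esub> ?emb (Suc i) s [^]\<^bsub>?P\<^esub> k = ?emb (Suc i) s [^]\<^bsub>?P\<^esub> Suc k"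
          using P.nat_pow_Suc2[OF in_P[OF iT(1) s]] by simp
        finally show ?case .
      qed
      obtain x where x: "x \<in> X" using nonempty by blast
      have "?emb (Suc i) s [^]\<^bsub>?P\<^esub> n = \<one>\<^bsub>?P\<^esub>"
        using emb.hom_nat_pow[OF sC, of n] n(2) emb.hom_one by metis
      then have "(T ^^ n) x = x"
        using pow[OF x, of n] action(3)[OF x] by metis
      then show ?thesis
        using torsion_has_fixed_point[OF _ x n(1)] action(1)[OF in_P[OF iT(1) s]] T by blast
    qed
    show "T (U x) = U (T x)"
      if ij: "i < d" "j < d" "i \<noteq> j" "T \<in> R i" "U \<in> R j" and x: "x \<in> X" for i j T U x
    proof -
      obtain s t where s: "s \<in> S (Suc i)" "T = \<phi> (?emb (Suc i) s)"
        and t: "t \<in> S (Suc j)" "U = \<phi> (?emb (Suc j) t)"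
        using ij by (auto simp: R_def)
      have "?emb (Suc i) s \<otimes>\<^bsub>?P\<^esub> ?emb (Suc j) t = ?emb (Suc j) t \<otimes>\<^bsub>?P\<^esub> ?emb (Suc i) s"
        using sub s(1) t(1) ij SucI
        by (intro factor_embeddings_commute grp) blast+
      then show ?thesis
        using action(2)[OF in_P[OF ij(1) s(1)] in_P[OF ij(2) t(1)] x]
          action(2)[OF in_P[OF ij(2) t(1)] in_P[OF ij(1) s(1)] x] s(2) t(2) by metis
    qed
  qed
  then obtain i x where i: "i < d" and x: "x \<in> X" "\<And>s. s \<in> S (Suc i) \<Longrightarrow> \<phi> (?emb (Suc i) s) x = x"
    by (auto simp: Fix_def R_def)
  interpret \<Gamma>i: group "\<Gamma> (Suc i)" by (rule grp[OF SucI[OF i]])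
  interpret emb: group_hom "\<Gamma> (Suc i)" ?P "?emb (Suc i)"
    by unfold_locales (rule emb_hom[OF _ SucI[OF i]])
  \<comment> \<open>The elements whose image under \<open>\<phi>\<close> fixes \<open>x\<close> form a subgroup; it contains the generators of the factor, hence the factor.\<close>
  have inv_fixed: "\<phi> (inv\<^bsub>?P\<^esub> g) x = x" if "g \<in> carrier ?P" "\<phi> g x = x" for g
    using action(2)[OF _ that(1) x(1), of "inv\<^bsub>?P\<^esub> g"] action(3)[OF x(1)] that
      P.inv_closed[OF that(1)] P.l_inv[OF that(1)] by metis
  have "\<phi> (?emb (Suc i) g) x = x" if "g \<in> generate (\<Gamma> (Suc i)) (S (Suc i))" for g
    using that
  proof (induction rule: generate.induct)
    case one
    then show ?case using emb.hom_one action(3)[OF x(1)] by metis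
  next
    case (incl s)
    then show ?case by (rule x(2))
  next
    case (inv s)
    have "s \<in> carrier (\<Gamma> (Suc i))" using inv sub[OF SucI[OF i]] by blast
    then have "?emb (Suc i) (inv\<^bsub>\<Gamma> (Suc i)\<^esub> s) = inv\<^bsub>?P\<^esub> ?emb (Suc i) s" by (rule emb.hom_inv)
    then show ?case using inv_fixed[OF in_P[OF i inv] x(2)[OF inv]] by metis
  next
    case (eng g h)
    have gh: "g \<in> carrier (\<Gamma> (Suc i))" "h \<in> carrier (\<Gamma> (Suc i))"
      using eng.hyps gen[OF SucI[OF i]] by auto
    have "\<phi> (?emb (Suc i) (g \<otimes>\<^bsub>\<Gamma> (Suc i)\<^esub> h)) x = \<phi> (?emb (Suc i) g) (\<phi> (?emb (Suc i) h) x)"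
      using action(2)[OF emb.hom_closed[OF gh(1)] emb.hom_closed[OF gh(2)] x(1)] emb.hom_mult[OF gh]
      by metis
    then show ?case using eng.IH by simp
  qed
  then have "\<forall>h\<in>factor_subgroup ?I \<Gamma> (Suc i). \<phi> h x = x"
    using factor_subgroup_eq_embedding[where I = ?I and G = \<Gamma>, OF grp SucI[OF i]]
      gen[OF SucI[OF i]] by auto
  then show ?thesis
    using x(1) SucI[OF i] unfolding has_fixed_point_def by blast
qed

end
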